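(* Fix integers $s,b\ge1$ and let $\{a_i\}$ be the $(s,b)$-Generacci sequence. For $z\in I_n:=[a_{b(n-1)+1},a_{bn+1})$ with $k(z)$ summands in its legal decomposition and bin gaps $G_1,\dots,G_{k(z)-1}$, define the spacing bin gap measure $\nu_{z,n}(x)=\frac{1}{k(z)-1}\sum_{j=1}^{k(z)-1}\delta(x-G_j)$. Let $\nu(x)=\sum_{g}P(g)\delta(x-g)$ be the limiting average bin gap measure, where $P(g)=\lim_{n\to\infty}P_n(g)$ and $P_n(g)$ is the fraction of all bin gaps of all $m\in I_n$ that equal $g$. Then for $z$ chosen uniformly from $I_n$, the measures $\nu_{z,n}$ converge almost surely in distribution to $\nu$ as $n\to\infty$.
   Context: Fix integers $s,b\ge1$. For an increasing sequence of positive integers $\{a_i\}_{i\ge1}$ define bins $\mathcal{B}_n=\{a_{b(n-1)+1},\dots,a_{bn}\}$ for $n\ge1$, with $\mathcal{B}_j=\emptyset$ for $j\le 0$. A decomposition $m=a_{\ell_1}+\dots+a_{\ell_k}$ with $a_{\ell_1}>\dots>a_{\ell_k}$ is an $(s,b)$-Generacci legal decomposition if $\{a_{\ell_i},a_{\ell_{i+1}}\}\not\subset\mathcal{B}_{j-s}\cup\dots\cup\mathcal{B}_j$ for all $i,j$. The $(s,b)$-Generacci sequence is the increasing sequence in which every $a_i$ is the smallest positive integer with no legal decomposition using $a_1,\dots,a_{i-1}$; every positive integer has a unique legal decomposition. For $m=a_{\ell_1}+\dots+a_{\ell_k}$ ($\ell_1>\dots>\ell_k$) its bin gaps are $\lceil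 \ell_i/b\rceil-\lceil \ell_{i+1}/b\rceil$, $1\le i\le k-1$. $\delta(x-a)$ denotes the Dirac point mass at $a$. *)

theory Defs
  imports "HOL-Probability.Probability"
begin

text \<open>Sequence a :: nat => nat, indexed from 1 (a 0 is irrelevant).
  Bin B_j as a set of values of the sequence; empty for j <= 0.\<close>
definition bin_vals :: "nat \<Rightarrow> (nat \<Rightarrow> nat) \<Rightarrow> int \<Rightarrow> nat set" where
  "bin_vals b a j = {a i | i. 1 \<le> j \<and> int b * (j - 1) + 1 \<le> int i \<and> int i \<le> int b * j}"

definition legal_dec :: "nat \<Rightarrow> nat \<Rightarrow> (nat \<Rightarrow> nat) \<Rightarrow> nat set \<Rightarrow> nat set \<Rightarrow> nat \<Rightarrow> bool" where
  "legal_dec s b a N L m \<longleftrightarrow>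
     finite L \<and> L \<noteq> {} \<and> L \<subseteq> N \<and> inj_on a L \<and> m = (\<Sum>l\<in>L. a l) \<and>
     (\<forall>l\<in>L. \<forall>l'\<in>L. (a l' < a l \<and> \<not> (\<exists>x\<in>L. a l' < a x \<and> a x < a l)) \<longrightarrow>
        \<not> (\<exists>j::int. {a l, a l'} \<subseteq> (\<Union>k\<in>{j - int s..j}. bin_vals b a k)))"

definition is_generacci :: "nat \<Rightarrow> nat \<Rightarrow> (nat \<Rightarrow> nat) \<Rightarrow> bool" where
  "is_generacci s b a \<longleftrightarrow>
     (\<forall>i\<ge>1. a i = (LEAST m::nat. 0 < m \<and> \<not> (\<exists>L. legal_dec s b a {1..<i} L m)))"

definition dec :: "nat \<Rightarrow> nat \<Rightarrow> (nat \<Rightarrow> nat) \<Rightarrow> nat \<Rightarrow> nat set" where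
  "dec s b a m = (THE L. legal_dec s b a {1..} L m)"

text \<open>Bin gaps ceil(l_i/b) - ceil(l_(i+1)/b) of consecutive summands (listed
  in increasing order of the indices, which does not affect the multiset).\<close>
definition bin_gaps :: "nat \<Rightarrow> nat \<Rightarrow> (nat \<Rightarrow> nat) \<Rightarrow> nat \<Rightarrow> int list" where
  "bin_gaps s b a m =
     (let xs = sorted_list_of_set (dec s b a m)
      in map2 (\<lambda>x y. \<lceil>real y / real b\<rceil> - \<lceil>real x / real b\<rceil>) xs (tl xs))"

definition Iint :: "nat \<Rightarrow> (nat \<Rightarrow> nat) \<Rightarrow> nat \<Rightarrow> nat set" where
  "Iint b a n = {a (b * (n - 1) + 1) ..< a (b * n + 1)}"

definition point_masses :: "(int \<Rightarrow> real) \<Rightarrow> real measure" where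
  "point_masses w = distr (density (count_space UNIV) (\<lambda>g. ennreal (w g))) borel real_of_int"

definition gap_measure :: "nat \<Rightarrow> nat \<Rightarrow> (nat \<Rightarrow> nat) \<Rightarrow> nat \<Rightarrow> real measure" where
  "gap_measure s b a z =
     point_masses (\<lambda>g. real (count_list (bin_gaps s b a z) g) / real (length (bin_gaps s b a z)))"

definition Pn :: "nat \<Rightarrow> nat \<Rightarrow> (nat \<Rightarrow> nat) \<Rightarrow> nat \<Rightarrow> int \<Rightarrow> real" where
  "Pn s b a n g =
     real (\<Sum>m\<in>Iint b a n. count_list (bin_gaps s b a m) g) /
     real (\<Sum>m\<in>Iint b a n. length (bin_gaps s b a m))"

definition Plim :: "nat \<Rightarrow> nat \<Rightarrow> (nat \<Rightarrow> nat) \<Rightarrow> int \<Rightarrow> real" where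
  "Plim s b a g = lim (\<lambda>n. Pn s b a n g)"

definition avg_gap_measure :: "nat \<Rightarrow> nat \<Rightarrow> (nat \<Rightarrow> nat) \<Rightarrow> real measure" where
  "avg_gap_measure s b a = point_masses (Plim s b a)"

end

theory Submission
  imports Defs
begin

text \<open>
  Splitting off the largest summand shows that the elements of \<open>I\<^sub>n\<close> are encoded by their
  sequences of bin gaps, weighted by powers of \<open>b\<close>, with all gaps larger than \<open>s\<close>.  If
  \<open>\<lambda> > 1\<close> solves \<open>\<lambda>\<^sup>s (\<lambda> - 1) = b\<close>, the weights \<open>b \<lambda>\<^sup>-\<^sup>g\<close> for \<open>g > s\<close> sum to one, so up to
  boundary effects the gaps form a renewal process with this gap distribution, which is the limit
  \<open>P\<close>.  A Chernoff bound (an exponentially tilted count grows like \<open>\<mu>\<^sup>n\<close> with \<open>\<mu> < \<lambda>\<close>, whereas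
  \<open>I\<^sub>n\<close> has at least order \<open>\<lambda>\<^sup>n\<close> elements) makes the proportion of \<open>z\<close> whose frequency of a
  gap deviates from \<open>P\<close> exponentially small.  This yields the limit of \<open>P\<^sub>n\<close> and, through
  Borel--Cantelli, the almost sure convergence of the frequencies.
\<close>

section \<open>Legal decompositions and their gaps\<close>

locale generacci =
  fixes s b :: nat and a :: "nat \<Rightarrow> nat"
  assumes b_pos: "0 < b" and generacci: "is_generacci s b a"
begin

section \<open>Bin numbers and separated index sets\<close>

definition bin :: "nat \<Rightarrow> nat" where
  "bin i = (i - 1) div b + 1"

text \<open>Legality constrains neighbouring summands only; demanding the condition of all pairs is
  equivalent by \<open>legal_dec_iff\<close> and passes to subsets, which suits recursion.\<close>

definition separated :: "nat set \<Rightarrow> bool" where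
  "separated L \<longleftrightarrow> (\<forall>l\<in>L. \<forall>l'\<in>L. l' < l \<longrightarrow> bin l' + s < bin l)"

definition separated_below :: "nat \<Rightarrow> nat set set" where
  "separated_below i = {L. L \<subseteq> {1..<i} \<and> separated L}"

text \<open>The positive indices below it are exactly those that may accompany \<open>l\<close> as
  smaller summands. Truncated subtraction gives 1, hence no such index, when \<open>bin l\<close> is
  at most \<open>s + 1\<close>.\<close>

definition cutoff :: "nat \<Rightarrow> nat" where
  "cutoff l = b * (bin l - 1 - s) + 1"

lemma bin_mono: "i \<le> j \<Longrightarrow> bin i \<le> bin j"
  by (simp add: bin_def div_le_mono)

lemma less_cutoff_iff:
  assumes "1 \<le> l'"
  shows "l' < cutoff l \<longleftrightarrow> bin l' + s < bin l"
proof -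
  have "l' < cutoff l \<longleftrightarrow> l' - 1 < (bin l - 1 - s) * b"
    using assms by (auto simp: cutoff_def mult.commute)
  also have "\<dots> \<longleftrightarrow> (l' - 1) div b < bin l - 1 - s"
    using b_pos by (simp add: div_less_iff_less_mult)
  also have "\<dots> \<longleftrightarrow> bin l' + s < bin l"
    by (auto simp: bin_def)
  finally show ?thesis .
qed

lemma cutoff_le: "1 \<le> l \<Longrightarrow> cutoff l \<le> l"
  using less_cutoff_iff[of l l] by auto

lemma bin_eqI:
  assumes "l \<in> {b * (n - 1) + 1..<b * n + 1}"
  shows "bin l = n"
proof (cases n)
  case (Suc k)
  have "(l - 1) div b = k"
    by (rule div_nat_eqI) (use assms Suc in \<open>auto simp: mult.commute\<close>)
  then show ?thesis using Suc by (simp add: bin_def)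
qed (use assms in auto)

lemma bin_bounds:
  assumes "1 \<le> i"
  shows "b * (bin i - 1) < i" "i \<le> b * bin i"
proof -
  have "b * ((i - 1) div b) \<le> i - 1" by (rule times_div_less_eq_dividend)
  then show "b * (bin i - 1) < i" using assms unfolding bin_def add_diff_cancel_right' by linarith
  have "i - 1 < b + b * ((i - 1) div b)"
    using b_pos by (metis dividend_less_times_div)
  then show "i \<le> b * bin i" using assms by (simp add: bin_def)
qed

lemma ceiling_divide_b:
  assumes "1 \<le> i"
  shows "\<lceil>real i / real b\<rceil> = int (bin i)"
proof (rule ceiling_unique)
  have "real (b * (bin i - 1)) < real i"
    using bin_bounds[OF assms] by (simp only: of_nat_less_iff)
  then show "real_of_int (int (bin i)) - 1 < real i / real b"
    using b_pos by (simp add: bin_def field_simps)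
  have "real i \<le> real (b * bin i)"
    using bin_bounds[OF assms] by (simp only: of_nat_le_iff)
  then show "real i / real b \<le> real_of_int (int (bin i))"
    using b_pos by (simp add: field_simps)
qed

section \<open>Well-definedness and monotonicity of the sequence\<close>

lemma ex_not_legal:
  "\<exists>m>0. \<not> (\<exists>L. legal_dec s b a {1..<i} L m)"
proof -
  \<comment> \<open>Legal sums are bounded by the sum of all available terms, so
    \<open>LEAST\<close> in the definition ranges over a nonempty set.\<close>
  have "m \<le> (\<Sum>l\<in>{1..<i}. a l)" if "legal_dec s b a {1..<i} L m" for L m
    using that by (auto simp: legal_dec_def intro!: sum_mono2)
  then show ?thesis
    by (metis lessI less_le_trans not_less zero_less_Suc)
qed

lemma a_Least:
  "1 \<le> i \<Longrightarrow> a i = (LEAST m. 0 < m \<and> \<not> (\<exists>L. legal_dec s b a {1..<i} L m))"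
  using generacci by (auto simp: is_generacci_def)

lemma a_pos: "1 \<le> i \<Longrightarrow> 0 < a i"
  and a_not_legal: "1 \<le> i \<Longrightarrow> \<not> legal_dec s b a {1..<i} L (a i)"
  and legal_below: "1 \<le> i \<Longrightarrow> 0 < m \<Longrightarrow> m < a i \<Longrightarrow> \<exists>L. legal_dec s b a {1..<i} L m"
  using LeastI_ex[OF ex_not_legal[of i]] not_less_Least[of m] a_Least[of i]
  by auto

lemma legal_mono: "legal_dec s b a N L m \<Longrightarrow> N \<subseteq> M \<Longrightarrow> legal_dec s b a M L m"
  by (auto simp: legal_dec_def)

text \<open>If \<open>a j < a i\<close>, then \<open>a j\<close> would be legal already from indices
  below \<open>i\<close>; if \<open>a j = a i\<close>, then \<open>{i}\<close> would decompose it.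
  Both contradict the choice of \<open>a j\<close>.\<close>

lemma a_less:
  assumes "1 \<le> i" "i < j"
  shows "a i < a j"
proof -
  have leg: "legal_dec s b a {1..<j} {i} (a i)"
    using assms by (auto simp: legal_dec_def)
  have "\<not> a j < a i"
  proof
    assume "a j < a i"
    then obtain L where "legal_dec s b a {1..<i} L (a j)"
      using legal_below[of i "a j"] a_pos[of j] assms by auto
    then have "legal_dec s b a {1..<j} L (a j)"
      using assms by (auto elim!: legal_mono)
    then show False using a_not_legal[of j L] assms by auto
  qed
  moreover have "a j \<noteq> a i"
    using leg a_not_legal[of j "{i}"] assms by auto
  ultimately show ?thesis by simp
qed

lemma a_le: "1 \<le> i \<Longrightarrow> i \<le> j \<Longrightarrow> a i \<le> a j"
  using a_less[of i j] by (cases "i = j") auto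

lemma a_less_iff: "1 \<le> i \<Longrightarrow> 1 \<le> j \<Longrightarrow> a i < a j \<longleftrightarrow> i < j"
  using a_less[of i j] a_le[of j i] by (cases "i < j") auto

lemma a_eq_iff: "1 \<le> i \<Longrightarrow> 1 \<le> j \<Longrightarrow> a i = a j \<longleftrightarrow> i = j"
  using a_less[of i j] a_less[of j i] by (metis less_irrefl linorder_neqE_nat)

section \<open>Legality as separation of bin numbers\<close>

lemma mem_bin_vals_iff:
  assumes "1 \<le> i"
  shows "a i \<in> bin_vals b a j \<longleftrightarrow> j = int (bin i)"
proof
  assume "a i \<in> bin_vals b a j"
  then obtain k where k: "a i = a k" "1 \<le> j" "int b * (j - 1) + 1 \<le> int k" "int k \<le> int b * j"
    by (auto simp: bin_vals_def)
  define n where "n = nat (j - 1)"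
  have j: "j = int (Suc n)" using k(2) by (simp add: n_def)
  have "int (b * n) + 1 \<le> int k" "int k \<le> int (b * Suc n)"
    using k(3,4) by (simp_all add: j algebra_simps)
  then have kk: "b * n + 1 \<le> k" "k \<le> b * Suc n" by linarith+
  \<comment> \<open>Bins are sets of values, so the index is recovered through injectivity of
    \<open>a\<close>.\<close>
  then have "i = k" using k(1) a_eq_iff[of i k] assms by simp
  moreover have "bin k = Suc n"
    by (rule bin_eqI) (use kk in \<open>auto simp: algebra_simps\<close>)
  ultimately show "j = int (bin i)" by (simp add: j)
next
  assume j: "j = int (bin i)"
  define n where "n = bin i - 1"
  have n: "bin i = Suc n" by (simp add: n_def bin_def)
  have "b * n < i" "i \<le> b * Suc n"
    using bin_bounds[OF assms] by (simp_all add: n)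
  then have "int (b * n) + 1 \<le> int i" "int i \<le> int (b * Suc n)" by linarith+
  then show "a i \<in> bin_vals b a j"
    unfolding bin_vals_def j n by (intro CollectI exI[of _ i]) (simp add: algebra_simps)
qed

text \<open>If any window contains both values, the one ending at the bin of the larger index
  does.\<close>

lemma common_window_iff:
  assumes "1 \<le> l" "1 \<le> l'" "l' < l"
  shows "(\<exists>j::int. {a l, a l'} \<subseteq> (\<Union>k\<in>{j - int s..j}. bin_vals b a k)) \<longleftrightarrow> bin l \<le> bin l' + s"
    (is "?L \<longleftrightarrow> ?R")
proof
  assume ?L
  then obtain j k k' where "k \<in> {j - int s..j}" "k' \<in> {j - int s..j}"
    "a l \<in> bin_vals b a k" "a l' \<in> bin_vals b a k'" by auto
  then show ?R using mem_bin_vals_iff[of l k] mem_bin_vals_iff[of l' k'] assms by auto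
next
  assume ?R
  have "a l \<in> bin_vals b a (int (bin l))" "a l' \<in> bin_vals b a (int (bin l'))"
    using mem_bin_vals_iff assms by auto
  moreover have "int (bin l) \<in> {int (bin l) - int s..int (bin l)}"
    "int (bin l') \<in> {int (bin l) - int s..int (bin l)}"
    using \<open>?R\<close> bin_mono[of l' l] assms by auto
  ultimately show ?L by blast
qed

text \<open>For an arbitrary pair, the predecessor of the larger index in \<open>L\<close> carries
  the condition, because \<open>bin\<close> is monotone. Values are ordered like indices, so the
  injectivity clause is automatic.\<close>

lemma legal_dec_iff:
  assumes "N \<subseteq> {1..}"
  shows "legal_dec s b a N L m \<longleftrightarrow>
    finite L \<and> L \<noteq> {} \<and> L \<subseteq> N \<and> m = sum a L \<and> separated L"
proof (cases "finite L \<and> L \<subseteq> N")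
  case True
  then have fin: "finite L" and ge1: "\<And>l. l \<in> L \<Longrightarrow> 1 \<le> l" using assms by auto
  have inj: "inj_on a L" using ge1 a_eq_iff by (auto simp: inj_on_def)
  have "(\<forall>l\<in>L. \<forall>l'\<in>L. (a l' < a l \<and> \<not> (\<exists>x\<in>L. a l' < a x \<and> a x < a l)) \<longrightarrow>
        \<not> (\<exists>j::int. {a l, a l'} \<subseteq> (\<Union>k\<in>{j - int s..j}. bin_vals b a k)))
     \<longleftrightarrow> (\<forall>l\<in>L. \<forall>l'\<in>L. (l' < l \<and> \<not> (\<exists>x\<in>L. l' < x \<and> x < l)) \<longrightarrow> bin l' + s < bin l)"
  proof (intro ball_cong refl)
    fix l l' assume l: "l \<in> L" "l' \<in> L"
    have "(\<exists>x\<in>L. a l' < a x \<and> a x < a l) \<longleftrightarrow> (\<exists>x\<in>L. l' < x \<and> x < l)"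
      by (intro bex_cong refl) (use l ge1 in \<open>auto simp: a_less_iff\<close>)
    moreover have "a l' < a l \<longleftrightarrow> l' < l"
      by (rule a_less_iff) (use l ge1 in auto)
    moreover have "l' < l \<Longrightarrow>
        (\<not> (\<exists>j::int. {a l, a l'} \<subseteq> (\<Union>k\<in>{j - int s..j}. bin_vals b a k))) \<longleftrightarrow> bin l' + s < bin l"
      by (subst common_window_iff) (use l ge1 in auto)
    ultimately show "(a l' < a l \<and> \<not> (\<exists>x\<in>L. a l' < a x \<and> a x < a l) \<longrightarrow>
        \<not> (\<exists>j::int. {a l, a l'} \<subseteq> (\<Union>k\<in>{j - int s..j}. bin_vals b a k)))
      \<longleftrightarrow> (l' < l \<and> \<not> (\<exists>x\<in>L. l' < x \<and> x < l) \<longrightarrow> bin l' + s < bin l)"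
      by argo
  qed
  also have "\<dots> \<longleftrightarrow> separated L"
  proof
    assume *: "\<forall>l\<in>L. \<forall>l'\<in>L. (l' < l \<and> \<not> (\<exists>x\<in>L. l' < x \<and> x < l)) \<longrightarrow> bin l' + s < bin l"
    show "separated L"
      unfolding separated_def
    proof (intro ballI impI)
      fix l l' assume l: "l \<in> L" "l' \<in> L" "l' < l"
      define A where "A = {x\<in>L. x < l}"
      have A: "finite A" "l' \<in> A" using fin l by (auto simp: A_def)
      define x where "x = Max A"
      have "x \<in> A" "l' \<le> x" "\<And>y. y \<in> A \<Longrightarrow> y \<le> x"
        using A Max_in[of A] by (auto simp: x_def simp del: Max_in)
      then have "bin x + s < bin l"
        using * l by (fastforce simp: A_def)
      then show "bin l' + s < bin l" using bin_mono[OF \<open>l' \<le> x\<close>] by simp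
    qed
  qed (auto simp: separated_def)
  finally show ?thesis using True inj by (auto simp: legal_dec_def)
qed (auto simp: legal_dec_def)

lemma legal_dec_below_iff:
  "legal_dec s b a {1..<i} L m \<longleftrightarrow> L \<in> separated_below i \<and> L \<noteq> {} \<and> m = sum a L"
  by (subst legal_dec_iff) (auto simp: separated_below_def intro: finite_subset)

lemma finite_separated_below: "L \<in> separated_below i \<Longrightarrow> finite L"
  by (auto simp: separated_below_def intro: finite_subset)

lemma sum_a_pos: "L \<in> separated_below i \<Longrightarrow> L \<noteq> {} \<Longrightarrow> 0 < sum a L"
  using a_pos finite_separated_below[of L i]
  unfolding separated_below_def by (intro sum_pos) fastforce+

section \<open>Recurrence for the sequence and unique representation\<close>

lemma a_one: "a 1 = 1"
  unfolding a_Least[OF order_refl]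
  by (rule Least_equality) (auto simp: legal_dec_def)

lemma separated_below_Suc:
  assumes "1 \<le> l"
  shows "separated_below (Suc l) = separated_below l \<union> insert l ` separated_below (cutoff l)"
proof (intro equalityI subsetI)
  fix L assume L: "L \<in> separated_below (Suc l)"
  show "L \<in> separated_below l \<union> insert l ` separated_below (cutoff l)"
  proof (cases "l \<in> L")
    case True
    have "l' < cutoff l" if "l' \<in> L - {l}" for l'
      using that L True less_cutoff_iff[of l' l]
      by (auto simp: separated_below_def separated_def)
    then have "L - {l} \<subseteq> {1..<cutoff l}"
      using L by (force simp: separated_below_def)
    then have "L - {l} \<in> separated_below (cutoff l)"
      using L by (simp add: separated_below_def separated_def)
    moreover have "L = insert l (L - {l})" using True by auto
    ultimately show ?thesis by blast
  next
    case False
    then show ?thesis using L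
      by (force simp: separated_below_def less_Suc_eq)
  qed
next
  fix L assume "L \<in> separated_below l \<union> insert l ` separated_below (cutoff l)"
  then show "L \<in> separated_below (Suc l)"
  proof
    assume "L \<in> insert l ` separated_below (cutoff l)"
    then obtain L' where L': "L = insert l L'" "L' \<in> separated_below (cutoff l)" by auto
    then have *: "1 \<le> l' \<and> l' < l \<and> bin l' + s < bin l" if "l' \<in> L'" for l'
      using that less_cutoff_iff[of l' l] cutoff_le[OF assms]
      by (force simp: separated_below_def)
    then have "separated L"
      using L' by (fastforce simp: separated_below_def separated_def)
    moreover have "L \<subseteq> {1..<Suc l}" using * L'(1) assms by (auto simp: less_Suc_eq)
    ultimately show ?thesis by (simp add: separated_below_def)
  qed (auto simp: separated_below_def)
qed

text \<open>Strong induction on both claims together. Sums avoiding the top index \<open>l\<close>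
  fill \<open>{0..<a l}\<close>, those using it fill the adjacent interval of length
  \<open>a (cutoff l)\<close>; the right end of the union is the first number missed, hence the next
  term.\<close>

lemma sum_bij_aux:
  assumes "1 \<le> i"
  shows "bij_betw (sum a) (separated_below i) {0..<a i} \<and>
    (\<forall>l. i = Suc l \<longrightarrow> 1 \<le> l \<longrightarrow> a i = a l + a (cutoff l))"
  using assms
proof (induction i rule: less_induct)
  case (less i)
  show ?case
  proof (cases "i = 1")
    case True
    have "separated_below 1 = {{}}" by (auto simp: separated_below_def separated_def)
    then show ?thesis using True a_one by (auto simp: bij_betw_def)
  next
    case False
    then obtain l where i: "i = Suc l" "1 \<le> l" using less.prems by (cases i) auto
    let ?T = "cutoff l"
    have T: "1 \<le> ?T" "?T \<le> l" using cutoff_le[OF i(2)] by (auto simp: cutoff_def)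
    have IH1: "bij_betw (sum a) (separated_below l) {0..<a l}"
      and IH2: "bij_betw (sum a) (separated_below ?T) {0..<a ?T}"
      using less.IH[of l] less.IH[of ?T] i T by auto
    have notin: "l \<notin> L'" "finite L'" if "L' \<in> separated_below ?T" for L'
      using that T finite_separated_below by (auto simp: separated_below_def)
    have bij_insert: "bij_betw (insert l) (separated_below ?T) (insert l ` separated_below ?T)"
      using notin by (auto simp: bij_betw_def inj_on_def insert_ident)
    have shift: "bij_betw ((+) (a l)) {0..<a ?T} {a l..<a l + a ?T}"
      by (rule bij_betwI[where g = "\<lambda>x. x - a l"]) auto
    have "bij_betw (sum a) (insert l ` separated_below ?T) {a l..<a l + a ?T}"
    proof -
      have "bij_betw (sum a \<circ> insert l) (separated_below ?T) {a l..<a l + a ?T}"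
        using bij_betw_trans[OF IH2 shift]
        by (rule bij_betw_cong[THEN iffD1, rotated]) (use notin in auto)
      then show ?thesis using bij_betw_comp_iff[OF bij_insert, of "sum a"] by auto
    qed
    then have "bij_betw (sum a) (separated_below i) ({0..<a l} \<union> {a l..<a l + a ?T})"
      unfolding i separated_below_Suc[OF i(2)] by (intro bij_betw_combine IH1) auto
    then have bij: "bij_betw (sum a) (separated_below i) {0..<a l + a ?T}"
      by (simp add: ivl_disj_un)
    \<comment> \<open>The empty set accounts for 0, which is not legal; all other sums are.\<close>
    have legal: "(\<exists>L. legal_dec s b a {1..<i} L m) \<longleftrightarrow> 0 < m \<and> m < a l + a ?T" for m
    proof
      assume "\<exists>L. legal_dec s b a {1..<i} L m"
      then obtain L where "L \<in> separated_below i" "L \<noteq> {}" "m = sum a L"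
        unfolding legal_dec_below_iff by blast
      then show "0 < m \<and> m < a l + a ?T"
        using sum_a_pos[of L i] bij by (auto simp: bij_betw_def)
    next
      assume m: "0 < m \<and> m < a l + a ?T"
      then have "m \<in> sum a ` separated_below i" using bij by (auto simp: bij_betw_def)
      then obtain L where "L \<in> separated_below i" "m = sum a L" by auto
      moreover from this have "L \<noteq> {}" using m by auto
      ultimately show "\<exists>L. legal_dec s b a {1..<i} L m" unfolding legal_dec_below_iff by blast
    qed
    have "a i = a l + a ?T"
      unfolding a_Least[OF less.prems] legal
      by (rule Least_equality) (use a_pos[OF i(2)] in auto)
    then show ?thesis using bij i(1) by auto
  qed
qed

lemma sum_bij: "1 \<le> i \<Longrightarrow> bij_betw (sum a) (separated_below i) {0..<a i}"
  and a_Suc: "1 \<le> l \<Longrightarrow> a (Suc l) = a l + a (cutoff l)"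
  using sum_bij_aux[of i] sum_bij_aux[of "Suc l"] by auto

text \<open>A competitor may use larger indices than \<open>L\<close>, so both sets are placed below
  a common bound \<open>j\<close>, where \<open>sum_bij\<close> gives injectivity.\<close>

lemma dec_sum:
  assumes "L \<in> separated_below i" "L \<noteq> {}"
  shows "dec s b a (sum a L) = L"
  unfolding dec_def
proof (rule the_equality)
  show "legal_dec s b a {1..} L (sum a L)"
    using assms by (subst legal_dec_iff) (auto simp: separated_below_def intro: finite_subset)
next
  fix L' assume "legal_dec s b a {1..} L' (sum a L)"
  then have L': "finite L'" "L' \<subseteq> {1..}" "separated L'" "sum a L' = sum a L"
    by (auto simp: legal_dec_iff)
  define j where "j = max i (Suc (Max (insert 1 L')))"
  have j: "1 \<le> j" by (auto simp: j_def)
  have "l < j" if "l \<in> L'" for l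
    using Max_ge[of "insert 1 L'" l] that L'(1) by (simp add: j_def less_max_iff_disj less_Suc_eq_le del: Max_insert)
  then have "L' \<in> separated_below j"
    using L' by (auto simp: separated_below_def)
  moreover have "L \<in> separated_below j"
    using assms unfolding separated_below_def j_def by fastforce
  ultimately show "L' = L"
    using sum_bij[OF j] L'(4) by (auto simp: bij_betw_def inj_on_def)
qed

section \<open>Gap lists and their recursion over the intervals \<open>Iint\<close>\<close>

lemma bin_gaps_a:
  assumes "1 \<le> l"
  shows "bin_gaps s b a (a l) = []"
proof -
  have "dec s b a (sum a {l}) = {l}"
    by (rule dec_sum[of _ "Suc l"]) (use assms in \<open>auto simp: separated_below_def separated_def\<close>)
  then show ?thesis by (simp add: bin_gaps_def)
qed

lemma map2_tl_snoc:
  "xs \<noteq> [] \<Longrightarrow> map2 f (xs @ [y]) (tl (xs @ [y])) = map2 f xs (tl xs) @ [f (last xs) y]"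
  by (induction xs) (auto simp: neq_Nil_conv)

text \<open>The largest index of \<open>z\<close> lies in bin \<open>j\<close>, so placing
  \<open>l\<close> of bin \<open>n\<close> on top creates just one new gap, at the end of the
  increasing list.\<close>

lemma bin_gaps_a_plus:
  assumes l: "l \<in> {b * (n - 1) + 1..<b * n + 1}"
    and j: "1 \<le> j" "j \<le> n - 1 - s" and z: "z \<in> Iint b a j"
  shows "bin_gaps s b a (a l + z) = bin_gaps s b a z @ [int n - int j]"
proof -
  have l1: "1 \<le> l" and bl: "bin l = n" using l bin_eqI by auto
  have T: "cutoff l = b * (n - 1 - s) + 1" by (simp add: cutoff_def bl)
  have zlt: "z < a (b * j + 1)" and zge: "a (b * (j - 1) + 1) \<le> z"
    using z by (auto simp: Iint_def)
  from zlt have "z \<in> sum a ` separated_below (b * j + 1)"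
    using sum_bij[of "b * j + 1"] by (auto simp: bij_betw_def)
  then obtain L where L: "L \<in> separated_below (b * j + 1)" and zL: "z = sum a L" by auto
  have fin: "finite L" using L by (rule finite_separated_below)
  have "L \<noteq> {}" using zge zL a_pos[of "b * (j - 1) + 1"] by auto
  \<comment> \<open>Sums over indices below bin \<open>j\<close> are smaller than the first term of
    that bin, so \<open>z\<close> must use an index of bin \<open>j\<close>.\<close>
  have "L \<notin> separated_below (b * (j - 1) + 1)"
    using bij_betwE[OF sum_bij[of "b * (j - 1) + 1"]] zge zL
    by (metis atLeastLessThan_iff le_add2 not_less)
  then obtain x where x: "x \<in> L" "b * (j - 1) + 1 \<le> x"
    using L by (force simp: separated_below_def)
  have "Max L \<in> L" using fin \<open>L \<noteq> {}\<close> by simp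
  moreover have "x \<le> Max L" using fin x by simp
  ultimately have "Max L \<in> {b * (j - 1) + 1..<b * j + 1}"
    using x L by (auto simp: separated_below_def)
  then have bM: "bin (Max L) = j" by (rule bin_eqI)
  have "b * j \<le> b * (n - 1 - s)" using j by simp
  then have "{1..<b * j + 1} \<subseteq> {1..<b * (n - 1 - s) + 1}" by auto
  then have L': "L \<in> separated_below (cutoff l)"
    using L unfolding T separated_below_def by blast
  then have insL: "insert l L \<in> separated_below (Suc l)"
    using separated_below_Suc[OF l1] by blast
  have less: "x < l" if "x \<in> L" for x
    using that L' cutoff_le[OF l1] by (auto simp: separated_below_def)
  have "a l + z = sum a (insert l L)" using fin less by (subst sum.insert) (auto simp: zL)
  then have dec1: "dec s b a (a l + z) = insert l L"
    using dec_sum[OF insL] by simp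
  have dec2: "dec s b a z = L" using dec_sum[OF L \<open>L \<noteq> {}\<close>] zL by simp
  let ?xs = "sorted_list_of_set L"
  have xs: "?xs \<noteq> []" using fin \<open>L \<noteq> {}\<close> by simp
  have snoc: "sorted_list_of_set (insert l L) = ?xs @ [l]"
  proof -
    have "sorted (?xs @ [l])" "distinct (?xs @ [l])"
      using fin less by (auto simp: sorted_append less_imp_le)
    from sorted_list_of_set.idem_if_sorted_distinct[OF this] show ?thesis
      using fin by simp
  qed
  have last: "last ?xs = Max L"
  proof (rule Max_eqI[OF fin, symmetric])
    show "last ?xs \<in> L" using last_in_set[OF xs] fin by simp
    have "sorted (butlast ?xs @ [last ?xs])" using xs by simp
    then have "\<forall>y\<in>set (butlast ?xs) \<union> {last ?xs}. y \<le> last ?xs"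
      unfolding sorted_append by auto
    moreover have "set (butlast ?xs @ [last ?xs]) = L" using fin xs by simp
    ultimately show "y \<le> last ?xs" if "y \<in> L" for y
      using that by (simp only: set_append list.set)
  qed
  have "1 \<le> Max L" using \<open>Max L \<in> L\<close> L by (auto simp: separated_below_def)
  then show ?thesis
    unfolding bin_gaps_def dec1 dec2 Let_def snoc map2_tl_snoc[OF xs] last
    by (simp only: ceiling_divide_b[OF l1] ceiling_divide_b[OF \<open>1 \<le> Max L\<close>] bl bM)
qed

lemma finite_Iint: "finite (Iint b a n)"
  by (simp add: Iint_def)

lemma sum_a_intervals:
  fixes F :: "nat \<Rightarrow> real"
  assumes "1 \<le> p" "p \<le> q"
  shows "(\<Sum>z\<in>{a p..<a q}. F z) = (\<Sum>l\<in>{p..<q}. \<Sum>z\<in>{a l..<a (Suc l)}. F z)"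
  using assms(2)
proof (induction q rule: dec_induct)
  case (step q)
  have "(\<Sum>z\<in>{a p..<a (Suc q)}. F z) = (\<Sum>z\<in>{a p..<a q}. F z) + (\<Sum>z\<in>{a q..<a (Suc q)}. F z)"
    using a_le[of p q] a_le[of q "Suc q"] step assms
    by (intro sum.atLeastLessThan_concat[symmetric]) auto
  then show ?case using step by simp
qed simp

lemma sum_Iint_below:
  fixes F :: "nat \<Rightarrow> real"
  shows "(\<Sum>z\<in>{1..<a (b * m + 1)}. F z) = (\<Sum>j\<in>{1..m}. \<Sum>z\<in>Iint b a j. F z)"
proof (induction m)
  case 0
  show ?case using a_one by simp
next
  case (Suc m)
  have "(\<Sum>z\<in>{1..<a (b * Suc m + 1)}. F z) =
      (\<Sum>z\<in>{1..<a (b * m + 1)}. F z) + (\<Sum>z\<in>{a (b * m + 1)..<a (b * Suc m + 1)}. F z)"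
    using a_pos[of "b * m + 1"] a_le[of "b * m + 1" "b * Suc m + 1"]
    by (intro sum.atLeastLessThan_concat[symmetric]) auto
  then show ?case using Suc by (simp add: Iint_def)
qed

text \<open>Each of the \<open>b\<close> possible top indices contributes equally: it stands alone,
  or on top of an element of some \<open>Iint b a j\<close>. Keeping \<open>F\<close> arbitrary lets
  one identity serve for cardinalities, for products over gaps and for induction.\<close>

lemma sum_Iint_bin_gaps:
  fixes F :: "int list \<Rightarrow> real"
  assumes "1 \<le> n"
  shows "(\<Sum>z\<in>Iint b a n. F (bin_gaps s b a z)) =
    b * (F [] + (\<Sum>j\<in>{1..n - 1 - s}. \<Sum>z\<in>Iint b a j. F (bin_gaps s b a z @ [int n - int j])))"
proof -
  let ?bin = "{b * (n - 1) + 1..<b * n + 1}"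
  have "(\<Sum>z\<in>Iint b a n. F (bin_gaps s b a z)) =
      (\<Sum>l\<in>?bin. \<Sum>z\<in>{a l..<a (Suc l)}. F (bin_gaps s b a z))"
    unfolding Iint_def by (rule sum_a_intervals) auto
  also have "\<dots> = (\<Sum>l\<in>?bin. F [] +
      (\<Sum>j\<in>{1..n - 1 - s}. \<Sum>z\<in>Iint b a j. F (bin_gaps s b a z @ [int n - int j])))"
  proof (rule sum.cong[OF refl])
    fix l assume l: "l \<in> ?bin"
    then have l1: "1 \<le> l" by simp
    have T: "cutoff l = b * (n - 1 - s) + 1" using bin_eqI[OF l] by (simp add: cutoff_def)
    have "(\<Sum>z\<in>{a l..<a (Suc l)}. F (bin_gaps s b a z)) =
        (\<Sum>z\<in>{0..<a (cutoff l)}. F (bin_gaps s b a (a l + z)))"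
      using sum.shift_bounds_nat_ivl[of "\<lambda>z. F (bin_gaps s b a z)" 0 "a l" "a (cutoff l)"]
      by (simp add: a_Suc[OF l1] add.commute)
    also have "\<dots> = F (bin_gaps s b a (a l)) +
        (\<Sum>z\<in>{1..<a (cutoff l)}. F (bin_gaps s b a (a l + z)))"
      using a_pos[of "cutoff l"] by (subst sum.atLeast_Suc_lessThan) (auto simp: cutoff_def)
    also have "\<dots> = F [] +
        (\<Sum>j\<in>{1..n - 1 - s}. \<Sum>z\<in>Iint b a j. F (bin_gaps s b a (a l + z)))"
      unfolding T sum_Iint_below bin_gaps_a[OF l1] ..
    also have "\<dots> = F [] +
        (\<Sum>j\<in>{1..n - 1 - s}. \<Sum>z\<in>Iint b a j. F (bin_gaps s b a z @ [int n - int j]))"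
    proof (intro arg_cong2[where f = "(+)"] refl sum.cong)
      fix j z assume "j \<in> {1..n - 1 - s}" "z \<in> Iint b a j"
      then show "F (bin_gaps s b a (a l + z)) = F (bin_gaps s b a z @ [int n - int j])"
        using bin_gaps_a_plus[OF l, of j z] by auto
    qed
    finally show "(\<Sum>z\<in>{a l..<a (Suc l)}. F (bin_gaps s b a z)) = \<dots>" .
  qed
  also have "card ?bin = b" using assms by (cases n) auto
  then have "(\<Sum>l\<in>?bin. c) = b * c" for c :: real by simp
  finally show ?thesis .
qed

end

section \<open>Exponential concentration of gap frequencies\<close>

context generacci
begin

text \<open>The summation identity applied to the indicator of failure of \<open>P\<close>: a
  vanishing sum of nonnegative terms has only zero terms.\<close>

lemma bin_gaps_induct:
  assumes "1 \<le> n" "z \<in> Iint b a n"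
    and Nil: "\<And>n. 1 \<le> n \<Longrightarrow> P n []"
    and snoc: "\<And>n j gs. 1 \<le> j \<Longrightarrow> j + s < n \<Longrightarrow> P j gs \<Longrightarrow> P n (gs @ [int n - int j])"
  shows "P n (bin_gaps s b a z)"
  using assms(1,2)
proof (induction n arbitrary: z rule: less_induct)
  case (less n)
  let ?F = "\<lambda>gs. if P n gs then 0 else 1 :: real"
  have "?F (bin_gaps s b a y @ [int n - int j]) = 0"
    if "j \<in> {1..n - 1 - s}" "y \<in> Iint b a j" for j y
    using snoc[of j n "bin_gaps s b a y"] less.IH[of j y] that by auto
  then have "(\<Sum>y\<in>Iint b a n. ?F (bin_gaps s b a y)) = 0"
    using Nil[OF less.prems(1)]
    by (subst sum_Iint_bin_gaps[OF less.prems(1)]) (simp del: One_nat_def)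
  then have "?F (bin_gaps s b a z) = 0"
    using less.prems(2) finite_Iint by (subst (asm) sum_nonneg_eq_0_iff) auto
  then show ?case by (simp split: if_splits)
qed

lemma length_bin_gaps_less: "1 \<le> n \<Longrightarrow> z \<in> Iint b a n \<Longrightarrow> length (bin_gaps s b a z) < n"
  by (rule bin_gaps_induct[where P = "\<lambda>n gs. length gs < n"]) auto

lemma bin_gaps_greater: "1 \<le> n \<Longrightarrow> z \<in> Iint b a n \<Longrightarrow> \<forall>g\<in>set (bin_gaps s b a z). int s < g"
  by (rule bin_gaps_induct[where P = "\<lambda>n gs. \<forall>g\<in>set gs. int s < g"]) auto

lemma card_Iint_pos: "1 \<le> n \<Longrightarrow> 0 < card (Iint b a n)"
  using a_less[of "b * (n - 1) + 1" "b * n + 1"] b_pos by (cases n) (auto simp: Iint_def)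

section \<open>Growth rate and size of the intervals\<close>

definition growth :: real where
  "growth = (SOME x::real. 1 < x \<and> x ^ s * (x - 1) = b)"

text \<open>Intermediate value theorem between 1, where the left side is 0, and
  \<open>b + 1\<close>, where it is at least \<open>b\<close>.\<close>

lemma growth_gt_1: "1 < growth"
  and growth_eq: "growth ^ s * (growth - 1) = b"
proof -
  have "\<exists>x::real. 1 \<le> x \<and> x \<le> real b + 1 \<and> x ^ s * (x - 1) = b"
  proof (rule IVT')
    show "real b \<le> (real b + 1) ^ s * (real b + 1 - 1)"
      using mult_right_mono[of 1 "(real b + 1) ^ s" "real b"] by (simp add: one_le_power)
  qed (auto intro!: continuous_intros)
  then obtain x :: real where "1 \<le> x" "x ^ s * (x - 1) = b" by blast
  then have "1 < x \<and> x ^ s * (x - 1) = b" using b_pos by (cases "x = 1") auto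
  then have "1 < growth \<and> growth ^ s * (growth - 1) = b"
    unfolding growth_def by (rule someI)
  then show "1 < growth" "growth ^ s * (growth - 1) = b" by auto
qed

text \<open>The bound reproduces itself in the counting recursion: the geometric sum telescopes to
  \<open>growth ^ m\<close>, and \<open>growth_eq\<close> turns the factor \<open>b\<close> into
  \<open>s\<close> further powers.\<close>

lemma card_Iint_ge:
  assumes "1 \<le> n"
  shows "(growth - 1) * growth ^ (n - 1) \<le> card (Iint b a n)"
  using assms
proof (induction n rule: less_induct)
  case (less n)
  define m where "m = n - 1 - s"
  \<comment> \<open>Only an inequality, since \<open>m\<close> is truncated to 0 when
    \<open>n - 1 < s\<close>.\<close>
  have "(growth - 1) * growth ^ (n - 1) \<le> (growth - 1) * growth ^ (s + m)"
    using growth_gt_1 by (intro mult_left_mono power_increasing) (auto simp: m_def)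
  also have "\<dots> = b * growth ^ m"
    unfolding growth_eq[symmetric] by (simp add: power_add)
  also have "growth ^ m = 1 + (\<Sum>j\<in>{1..m}. (growth - 1) * growth ^ (j - 1))"
    by (induction m) (auto simp: algebra_simps)
  also have "\<dots> \<le> 1 + (\<Sum>j\<in>{1..m}. real (card (Iint b a j)))"
    using less by (intro add_left_mono sum_mono less.IH) (auto simp: m_def)
  also have "b * (1 + (\<Sum>j\<in>{1..m}. real (card (Iint b a j)))) = card (Iint b a n)"
    using sum_Iint_bin_gaps[OF less.prems, of "\<lambda>_. 1"] by (simp add: m_def)
  finally show ?case using b_pos by (simp add: mult_left_mono)
qed

section \<open>Gap weights and exponential tilting\<close>

definition gap_weight :: "real \<Rightarrow> int \<Rightarrow> real" where
  "gap_weight x g = (if int s < g then b / x ^ nat g else 0)"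

lemma gap_weight_nonneg: "0 \<le> x \<Longrightarrow> 0 \<le> gap_weight x g"
  by (simp add: gap_weight_def)

text \<open>A geometric series starting at \<open>s + 1\<close>; its value is 1 at
  \<open>x = growth\<close>.\<close>

lemma gap_weight_sums:
  assumes "1 < x"
  shows "(\<lambda>k. gap_weight x (int k)) sums (b / (x ^ s * (x - 1)))"
proof -
  have "(\<lambda>k. (b / x ^ Suc s) * (1 / x) ^ k) sums ((b / x ^ Suc s) * (1 / (1 - 1 / x)))"
    using assms by (intro sums_mult geometric_sums) auto
  also have "(b / x ^ Suc s) * (1 / (1 - 1 / x)) = b / (x ^ s * (x - 1))"
    using assms by (simp add: field_simps)
  also have "(\<lambda>k. (b / x ^ Suc s) * (1 / x) ^ k) = (\<lambda>k. gap_weight x (int (k + Suc s)))"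
    by (auto simp: gap_weight_def power_add power_divide nat_add_distrib simp flip: of_nat_Suc of_nat_add)
  finally show ?thesis
    by (subst (asm) sums_iff_shift) (simp add: gap_weight_def)
qed

text \<open>The weighted totals satisfy a renewal recursion with kernel mass at most
  \<open>\<rho>\<close>. With \<open>K = b / (1 - \<rho>)\<close>, the sequence
  \<open>K * x ^ n\<close> is a supersolution because
  \<open>b + \<rho> * K * x ^ n \<le> K * x ^ n\<close>.\<close>

lemma sum_prod_bin_gaps_le:
  fixes h :: "int \<Rightarrow> real"
  assumes h: "\<And>g. 0 \<le> h g" and x: "1 \<le> x"
    and \<rho>: "\<And>m. (\<Sum>k<m. gap_weight x (int k) * h (int k)) \<le> \<rho>" "\<rho> < 1" and n: "1 \<le> n"
  shows "(\<Sum>z\<in>Iint b a n. prod_list (map h (bin_gaps s b a z))) \<le> b / (1 - \<rho>) * x ^ n"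
  using n
proof (induction n rule: less_induct)
  case (less n)
  define K where "K = b / (1 - \<rho>)"
  have K: "0 \<le> K" "b = (1 - \<rho>) * K" using \<rho>(2) by (auto simp: K_def)
  let ?J = "{1..n - 1 - s}"
  let ?W = "\<lambda>j. \<Sum>z\<in>Iint b a j. prod_list (map h (bin_gaps s b a z))"
  have "(\<Sum>j\<in>?J. gap_weight x (int (n - j)) * h (int (n - j))) =
      (\<Sum>k\<in>(\<lambda>j. n - j) ` ?J. gap_weight x (int k) * h (int k))"
    by (subst sum.reindex) (auto simp: inj_on_def)
  also have "\<dots> \<le> (\<Sum>k<n. gap_weight x (int k) * h (int k))"
    using x h less.prems by (intro sum_mono2) (auto intro!: mult_nonneg_nonneg gap_weight_nonneg)
  also have "\<dots> \<le> \<rho>" by (rule \<rho>)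
  finally have *: "(\<Sum>j\<in>?J. gap_weight x (int (n - j)) * h (int (n - j))) \<le> \<rho>" .
  have "?W n = b * (1 + (\<Sum>j\<in>?J. h (int n - int j) * ?W j))"
    by (subst sum_Iint_bin_gaps[OF less.prems]) (simp add: sum_distrib_left mult.commute)
  also have "\<dots> \<le> b * (1 + (\<Sum>j\<in>?J. h (int n - int j) * (K * x ^ j)))"
    using less h by (intro mult_left_mono add_left_mono sum_mono) (auto simp: K_def)
  also have "\<dots> = b + K * x ^ n * (\<Sum>j\<in>?J. gap_weight x (int (n - j)) * h (int (n - j)))"
  proof -
    have "b * (h (int n - int j) * (K * x ^ j)) =
        K * x ^ n * (gap_weight x (int (n - j)) * h (int (n - j)))" if "j \<in> ?J" for j
    proof -
      have j: "j \<le> n" "s < n - j" using that less.prems by auto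
      then have n: "x ^ n = x ^ j * x ^ (n - j)" by (simp flip: power_add)
      have "gap_weight x (int (n - j)) = b / x ^ (n - j)"
        using j(2) by (simp add: gap_weight_def del: of_nat_diff)
      moreover have "int n - int j = int (n - j)" using j by simp
      ultimately show ?thesis using x unfolding n by (simp del: of_nat_diff)
    qed
    then have "(\<Sum>j\<in>?J. b * (h (int n - int j) * (K * x ^ j))) =
        (\<Sum>j\<in>?J. K * x ^ n * (gap_weight x (int (n - j)) * h (int (n - j))))"
      by (rule sum.cong[OF refl])
    then show ?thesis by (simp only: distrib_left mult_1_right flip: sum_distrib_left)
  qed
  also have "\<dots> \<le> b + K * x ^ n * \<rho>"
    using * K x by (intro add_left_mono mult_left_mono) auto
  also have "b + K * x ^ n * \<rho> \<le> K * x ^ n"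
  proof -
    have "(1 - \<rho>) * K * 1 \<le> (1 - \<rho>) * K * x ^ n"
      using \<rho>(2) K x by (intro mult_left_mono one_le_power) auto
    then show ?thesis using K(2) by (simp add: algebra_simps)
  qed
  finally show ?case by (simp add: K_def)
qed

text \<open>A shifted geometric distribution on the integers above \<open>s\<close>; by
  \<open>gap_weight_sums\<close> and \<open>growth_eq\<close> its total mass is 1.\<close>

definition limit_gap :: "int \<Rightarrow> real" where
  "limit_gap = gap_weight growth"

lemma limit_gap_nonneg: "0 \<le> limit_gap g"
  using growth_gt_1 by (simp add: limit_gap_def gap_weight_nonneg)

text \<open>The exponential tilt is strictly subcritical at \<^term>\<open>growth\<close>, hence still
  subcritical slightly below it.\<close>
lemma tilt_subcritical:
  fixes \<sigma> \<epsilon> :: real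
  assumes "0 < \<epsilon>"
  obtains \<theta> x \<rho> :: real where "0 < \<theta>" "1 < x" "x < growth" "\<rho> < 1"
    "\<forall>m. (\<Sum>k<m. gap_weight x (int k) *
        exp (\<theta> * (\<sigma> * (of_bool (int k = g) - limit_gap g) - \<epsilon>))) \<le> \<rho>"
proof -
  define p where "p = limit_gap g"
  \<comment> \<open>The mean of the tilt when gaps follow \<open>limit_gap\<close>. The exponent has
    mean \<open>- \<epsilon>\<close> per unit of \<open>\<theta>\<close>, so \<open>\<phi>\<close>
    falls below \<open>\<phi> 0 = 1\<close> for small positive \<open>\<theta>\<close>.\<close>
  define \<phi> where "\<phi> = (\<lambda>\<theta>. (1 - p) * exp (\<theta> * (\<sigma> * (0 - p) - \<epsilon>)) + p * exp (\<theta> * (\<sigma> * (1 - p) - \<epsilon>)))"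
  have "(\<phi> has_real_derivative ((1 - p) * (\<sigma> * (0 - p) - \<epsilon>) + p * (\<sigma> * (1 - p) - \<epsilon>))) (at 0)"
    unfolding \<phi>_def by (auto intro!: derivative_eq_intros)
  also have "(1 - p) * (\<sigma> * (0 - p) - \<epsilon>) + p * (\<sigma> * (1 - p) - \<epsilon>) = - \<epsilon>"
    by (simp add: algebra_simps)
  finally obtain d where d: "0 < d" "\<And>h. 0 < h \<Longrightarrow> h < d \<Longrightarrow> \<phi> (0 + h) < \<phi> 0"
    using DERIV_neg_dec_right[of \<phi> "- \<epsilon>" 0] assms by auto
  define \<theta> where "\<theta> = d / 2"
  have \<theta>: "0 < \<theta>" "\<phi> \<theta> < 1" using d(1) d(2)[of \<theta>] by (auto simp: \<theta>_def \<phi>_def)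
  define \<alpha> where "\<alpha> = exp (\<theta> * (\<sigma> * (0 - p) - \<epsilon>))"
  define \<beta> where "\<beta> = exp (\<theta> * (\<sigma> * (1 - p) - \<epsilon>))"
  \<comment> \<open>Closed form of the tilted mass at rate \<open>x\<close>: factor
    \<open>\<alpha>\<close> for every gap, corrected to \<open>\<beta>\<close> at \<open>g\<close>.
    Continuity carries \<open>r growth < 1\<close> to some \<open>x < growth\<close>.\<close>
  define r where "r = (\<lambda>x. \<alpha> * (b / (x ^ s * (x - 1))) + (\<beta> - \<alpha>) * gap_weight x g)"
  have "r growth = \<phi> \<theta>"
  proof -
    have "r growth = \<alpha> + (\<beta> - \<alpha>) * p"
      using b_pos unfolding r_def growth_eq p_def limit_gap_def by simp
    also have "\<dots> = (1 - p) * \<alpha> + p * \<beta>" by (simp add: algebra_simps)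
    finally show ?thesis by (simp add: \<phi>_def \<alpha>_def \<beta>_def)
  qed
  moreover have "isCont r growth"
    using growth_gt_1 unfolding r_def gap_weight_def by (cases "int s < g") (auto intro!: continuous_intros)
  ultimately have "(r \<longlongrightarrow> \<phi> \<theta>) (at_left growth)"
    by (metis isCont_def tendsto_within_subset subset_UNIV)
  then have "eventually (\<lambda>x. r x < 1) (at_left growth)"
    using \<theta>(2) by (rule order_tendstoD)
  moreover have "eventually (\<lambda>x. x \<in> {1<..<growth}) (at_left growth)"
    by (rule eventually_at_left_real) (rule growth_gt_1)
  ultimately have "eventually (\<lambda>x. r x < 1 \<and> x \<in> {1<..<growth}) (at_left growth)"
    by (rule eventually_conj)
  then obtain x where x: "r x < 1" "1 < x" "x < growth"
    using eventually_happens'[OF trivial_limit_at_left_real] by auto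
  let ?h = "\<lambda>k. exp (\<theta> * (\<sigma> * (of_bool (int k = g) - limit_gap g) - \<epsilon>))"
  \<comment> \<open>For negative \<open>g\<close> the correction sits at \<open>nat g = 0\<close>,
    where the weight vanishes.\<close>
  have "(\<lambda>k. \<alpha> * gap_weight x (int k) + (if k = nat g then (\<beta> - \<alpha>) * gap_weight x (int k) else 0))
      sums (\<alpha> * (b / (x ^ s * (x - 1))) + (\<beta> - \<alpha>) * gap_weight x (int (nat g)))"
    by (intro sums_add sums_mult gap_weight_sums x sums_single)
  also have "gap_weight x (int (nat g)) = gap_weight x g"
    by (auto simp: gap_weight_def)
  also have "(\<lambda>k. \<alpha> * gap_weight x (int k) + (if k = nat g then (\<beta> - \<alpha>) * gap_weight x (int k) else 0)) =
      (\<lambda>k. gap_weight x (int k) * ?h k)"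
    by (auto simp: fun_eq_iff gap_weight_def \<alpha>_def \<beta>_def p_def algebra_simps)
  finally have sums: "(\<lambda>k. gap_weight x (int k) * ?h k) sums r x"
    by (simp add: r_def)
  have "(\<Sum>k<m. gap_weight x (int k) * ?h k) \<le> r x" for m
    unfolding sums_unique[OF sums] using x
    by (intro sum_le_suminf sums_summable[OF sums]) (auto intro!: mult_nonneg_nonneg gap_weight_nonneg)
  then show thesis using that[of \<theta> x "r x"] \<theta>(1) x by blast
qed

section \<open>Chernoff bounds for the number of deviating elements\<close>

abbreviation gap_count :: "nat \<Rightarrow> int \<Rightarrow> real" where
  "gap_count z g \<equiv> real (count_list (bin_gaps s b a z) g)"

abbreviation gap_total :: "nat \<Rightarrow> real" where
  "gap_total z \<equiv> real (length (bin_gaps s b a z))"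

text \<open>The tilted product over the gaps is at least 1 on the deviating set, so the set has at
  most order \<open>x ^ n\<close> elements, against order at least \<open>growth ^ n\<close> for
  \<open>Iint b a n\<close>. The sign of \<open>\<sigma>\<close> selects the side.\<close>

lemma one_sided_deviation:
  fixes \<sigma> \<epsilon> :: real
  assumes "0 < \<epsilon>"
  obtains K r :: real where "0 \<le> K" "0 < r" "r < 1"
    "\<forall>n\<ge>1. card {z \<in> Iint b a n. \<epsilon> * gap_total z \<le> \<sigma> * (gap_count z g - limit_gap g * gap_total z)}
      \<le> K * r ^ n * card (Iint b a n)"
proof -
  obtain \<theta> x \<rho> :: real where \<theta>: "0 < \<theta>" "1 < x" "x < growth" "\<rho> < 1"
    "\<forall>m. (\<Sum>k<m. gap_weight x (int k) *
        exp (\<theta> * (\<sigma> * (of_bool (int k = g) - limit_gap g) - \<epsilon>))) \<le> \<rho>"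
    by (rule tilt_subcritical[OF assms, of \<sigma> g])
  let ?h = "\<lambda>g'. exp (\<theta> * (\<sigma> * (of_bool (g' = g) - limit_gap g) - \<epsilon>))"
  let ?C = "b / (1 - \<rho>)"
  let ?K = "?C * growth / (growth - 1)"
  have C: "0 \<le> ?C" using \<theta> by auto
  have prod: "prod_list (map ?h gs) =
      exp (\<theta> * (\<sigma> * (count_list gs g - limit_gap g * length gs) - \<epsilon> * length gs))" for gs
    by (induction gs) (auto simp: algebra_simps simp flip: exp_add)
  have "card {z \<in> Iint b a n. \<epsilon> * gap_total z \<le> \<sigma> * (gap_count z g - limit_gap g * gap_total z)}
        \<le> ?K * (x / growth) ^ n * card (Iint b a n)" (is "real (card ?B) \<le> _") if n: "1 \<le> n" for n
  proof -
    have "real (card ?B) = (\<Sum>z\<in>?B. 1)" by simp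
    also have "\<dots> \<le> (\<Sum>z\<in>?B. prod_list (map ?h (bin_gaps s b a z)))"
      unfolding prod using \<theta>(1) by (intro sum_mono) auto
    also have "\<dots> \<le> (\<Sum>z\<in>Iint b a n. prod_list (map ?h (bin_gaps s b a z)))"
      unfolding prod using finite_Iint by (intro sum_mono2) auto
    also have "\<dots> \<le> ?C * x ^ n"
      using \<theta> n by (intro sum_prod_bin_gaps_le) auto
    also have "\<dots> = ?K * (x / growth) ^ n * ((growth - 1) * growth ^ (n - 1))"
    proof -
      have "growth ^ n = growth * growth ^ (n - 1)" using n by (cases n) auto
      then have "c * growth / (growth - 1) * (x / growth) ^ n * ((growth - 1) * growth ^ (n - 1)) = c * x ^ n" for c
        using growth_gt_1 by (simp add: power_divide)
      then show ?thesis by (rule sym)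
    qed
    also have "\<dots> \<le> ?K * (x / growth) ^ n * card (Iint b a n)"
      using card_Iint_ge[OF n] C growth_gt_1 \<theta>
      by (intro mult_left_mono mult_nonneg_nonneg divide_nonneg_nonneg zero_le_power) auto
    finally show ?thesis .
  qed
  moreover have "0 \<le> ?K" using \<theta>(4) growth_gt_1 by (intro divide_nonneg_nonneg mult_nonneg_nonneg) auto
  ultimately show thesis
    using that[of ?K "x / growth"] \<theta> growth_gt_1 by auto
qed

text \<open>The inequality is nonstrict and free of division, so elements without gaps count as
  deviant; outside this set frequencies have a positive denominator.\<close>

definition deviant :: "nat \<Rightarrow> int \<Rightarrow> real \<Rightarrow> nat set" where
  "deviant n g \<epsilon> = {z \<in> Iint b a n. \<epsilon> * gap_total z \<le> \<bar>gap_count z g - limit_gap g * gap_total z\<bar>}"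

lemma card_deviant_le:
  assumes "0 < \<epsilon>"
  obtains K r :: real where "0 \<le> K" "0 < r" "r < 1"
    "\<forall>n\<ge>1. card (deviant n g \<epsilon>) \<le> K * r ^ n * card (Iint b a n)"
proof -
  let ?B = "\<lambda>\<sigma> n. {z \<in> Iint b a n. \<epsilon> * gap_total z \<le> \<sigma> * (gap_count z g - limit_gap g * gap_total z)}"
  obtain K1 r1 :: real where 1: "0 \<le> K1" "0 < r1" "r1 < 1"
    "\<forall>n\<ge>1. card (?B 1 n) \<le> K1 * r1 ^ n * card (Iint b a n)"
    by (rule one_sided_deviation[OF assms, of 1 g])
  obtain K2 r2 :: real where 2: "0 \<le> K2" "0 < r2" "r2 < 1"
    "\<forall>n\<ge>1. card (?B (-1) n) \<le> K2 * r2 ^ n * card (Iint b a n)"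
    by (rule one_sided_deviation[OF assms, of "-1" g])
  let ?r = "max r1 r2"
  have "card (deviant n g \<epsilon>) \<le> (K1 + K2) * ?r ^ n * card (Iint b a n)" if n: "1 \<le> n" for n
  proof -
    have "deviant n g \<epsilon> \<subseteq> ?B 1 n \<union> ?B (-1) n" by (auto simp: deviant_def abs_if split: if_splits)
    then have "card (deviant n g \<epsilon>) \<le> card (?B 1 n \<union> ?B (-1) n)"
      using finite_Iint by (intro card_mono) auto
    also have "\<dots> \<le> card (?B 1 n) + card (?B (-1) n)" by (rule card_Un_le)
    finally have "real (card (deviant n g \<epsilon>)) \<le> real (card (?B 1 n)) + real (card (?B (-1) n))"
      by (simp only: of_nat_le_iff flip: of_nat_add)
    also have "\<dots> \<le> K1 * r1 ^ n * card (Iint b a n) + K2 * r2 ^ n * card (Iint b a n)"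
      using 1(4) 2(4) n by (intro add_mono) auto
    also have "\<dots> \<le> K1 * ?r ^ n * card (Iint b a n) + K2 * ?r ^ n * card (Iint b a n)"
      using 1 2 by (intro add_mono mult_right_mono mult_left_mono power_mono) auto
    finally show ?thesis by (simp add: algebra_simps)
  qed
  then show thesis using that[of "K1 + K2" ?r] 1 2 by auto
qed

lemma not_deviantD:
  assumes "z \<in> Iint b a n - deviant n g \<epsilon>"
  shows "0 < gap_total z" "\<bar>gap_count z g - limit_gap g * gap_total z\<bar> < \<epsilon> * gap_total z"
  using assms by (auto simp: deviant_def not_le intro!: Nat.gr0I)

end

section \<open>Limits of gap frequencies\<close>

text \<open>Masses on positive integers make the distribution function a finite sum, so convergence
  of the individual masses suffices and no tightness argument arises.\<close>

lemma cdf_point_masses: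
  assumes nonneg: "\<And>g. 0 \<le> w g" and zero: "\<And>g. g \<le> 0 \<Longrightarrow> w g = 0"
  shows "cdf (point_masses w) x = (\<Sum>g\<in>{1..\<lfloor>x\<rfloor>}. w g)"
proof -
  have "emeasure (point_masses w) {..x} =
      (\<integral>\<^sup>+ g. ennreal (w g) * indicator {g. real_of_int g \<le> x} g \<partial>count_space UNIV)"
    unfolding point_masses_def
    by (subst emeasure_distr) (auto simp: emeasure_density vimage_def)
  also have "\<dots> = (\<Sum>g\<in>{1..\<lfloor>x\<rfloor>}. ennreal (w g) * indicator {g. real_of_int g \<le> x} g)"
    by (rule nn_integral_count_space') (auto simp: zero le_floor_iff indicator_def not_le)
  also have "\<dots> = (\<Sum>g\<in>{1..\<lfloor>x\<rfloor>}. ennreal (w g))"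
    by (intro sum.cong) (auto simp: le_floor_iff)
  also have "\<dots> = ennreal (\<Sum>g\<in>{1..\<lfloor>x\<rfloor>}. w g)"
    by (rule sum_ennreal) (rule nonneg)
  finally show ?thesis
    by (simp add: cdf_def measure_def nonneg sum_nonneg)
qed

lemma abs_divide_diff: "0 < t \<Longrightarrow> \<bar>c / t - p\<bar> = \<bar>c - p * t\<bar> / t" for c t p :: real
  by (simp add: abs_if field_simps)

section \<open>Convergence of the average gap frequencies\<close>

context generacci
begin

text \<open>Regular elements contribute at most \<open>\<epsilon>\<close> per gap; deviant ones are
  bounded crudely, having fewer than \<open>n\<close> gaps each.\<close>

lemma sum_gap_deviation_le:
  assumes n: "1 \<le> n" and "0 < \<epsilon>"
  shows "\<bar>(\<Sum>z\<in>Iint b a n. gap_count z g) - limit_gap g * (\<Sum>z\<in>Iint b a n. gap_total z)\<bar>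
    \<le> \<epsilon> * (\<Sum>z\<in>Iint b a n. gap_total z) + (1 + limit_gap g) * n * card (deviant n g \<epsilon>)"
proof -
  let ?D = "deviant n g \<epsilon>"
  have pointwise: "\<bar>gap_count z g - limit_gap g * gap_total z\<bar>
      \<le> \<epsilon> * gap_total z + (1 + limit_gap g) * n * indicator ?D z" if z: "z \<in> Iint b a n" for z
  proof (cases "z \<in> ?D")
    case True
    have "gap_count z g \<le> gap_total z"
      by (simp add: count_le_length)
    moreover have "gap_total z \<le> n" using length_bin_gaps_less[OF n z] by simp
    moreover have "0 \<le> limit_gap g * gap_total z" by (simp add: limit_gap_nonneg)
    ultimately have "\<bar>gap_count z g - limit_gap g * gap_total z\<bar> \<le> (1 + limit_gap g) * gap_total z"
      by (simp add: algebra_simps)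
    also have "\<dots> \<le> (1 + limit_gap g) * n"
      using \<open>gap_total z \<le> n\<close> limit_gap_nonneg[of g] by (intro mult_left_mono) auto
    finally show ?thesis using True \<open>0 < \<epsilon>\<close> by (simp add: add_increasing)
  next
    case False
    then show ?thesis using not_deviantD[of z n g \<epsilon>] z by simp
  qed
  have "\<bar>(\<Sum>z\<in>Iint b a n. gap_count z g) - limit_gap g * (\<Sum>z\<in>Iint b a n. gap_total z)\<bar> =
      \<bar>\<Sum>z\<in>Iint b a n. gap_count z g - limit_gap g * gap_total z\<bar>"
    by (simp add: sum_subtractf sum_distrib_left)
  also have "\<dots> \<le> (\<Sum>z\<in>Iint b a n. \<epsilon> * gap_total z + (1 + limit_gap g) * n * indicator ?D z)"
    by (rule order_trans[OF sum_abs sum_mono]) (rule pointwise)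
  also have "\<dots> = \<epsilon> * (\<Sum>z\<in>Iint b a n. gap_total z) +
      (1 + limit_gap g) * n * (\<Sum>z\<in>Iint b a n. indicator ?D z)"
    by (simp only: sum.distrib sum_distrib_left)
  also have "(\<Sum>z\<in>Iint b a n. indicator ?D z) = real (card ?D)"
  proof -
    have "Iint b a n \<inter> {z. z \<in> ?D} = ?D" by (auto simp: deviant_def)
    then show ?thesis by (simp add: indicator_def finite_Iint)
  qed
  finally show ?thesis .
qed

text \<open>Every regular element has at least one gap, which keeps the denominator of
  \<open>Pn\<close> comparable to the size of the interval.\<close>

lemma sum_gap_total_ge:
  "real (card (Iint b a n)) - card (deviant n g \<epsilon>) \<le> (\<Sum>z\<in>Iint b a n. gap_total z)"
proof -
  let ?D = "deviant n g \<epsilon>"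
  have sub: "?D \<subseteq> Iint b a n" by (auto simp: deviant_def)
  have "real (card (Iint b a n)) - card ?D = (\<Sum>z\<in>Iint b a n - ?D. 1)"
    using card_Diff_subset[OF finite_subset[OF sub finite_Iint] sub] card_mono[OF finite_Iint sub]
    by (simp add: of_nat_diff)
  also have "\<dots> \<le> (\<Sum>z\<in>Iint b a n - ?D. gap_total z)"
  proof (rule sum_mono)
    fix z assume "z \<in> Iint b a n - ?D"
    then show "1 \<le> gap_total z" using not_deviantD(1)[of z n g \<epsilon>] by (simp add: Suc_le_eq)
  qed
  also have "\<dots> \<le> (\<Sum>z\<in>Iint b a n. gap_total z)"
    by (rule sum_mono2) (auto simp: finite_Iint)
  finally show ?thesis .
qed

text \<open>Exponential smallness of the deviant set beats the factor \<open>n\<close>. Regular and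
  deviant elements each cause an error of at most \<open>\<epsilon> * ?S\<close>, hence the choice
  \<open>\<epsilon> = e / 3\<close>.\<close>

lemma Pn_tendsto: "(\<lambda>n. Pn s b a n g) \<longlonglongrightarrow> limit_gap g"
proof (rule tendstoI)
  fix e :: real assume "0 < e"
  define \<epsilon> where "\<epsilon> = e / 3"
  have \<epsilon>: "0 < \<epsilon>" using \<open>0 < e\<close> by (simp add: \<epsilon>_def)
  obtain K r :: real where K: "0 \<le> K" "0 < r" "r < 1"
    "\<forall>n\<ge>1. card (deviant n g \<epsilon>) \<le> K * r ^ n * card (Iint b a n)"
    by (rule card_deviant_le[OF \<epsilon>, of g])
  have "(\<lambda>n. K * r ^ n) \<longlonglongrightarrow> K * 0"
    using K by (intro tendsto_mult_left LIMSEQ_realpow_zero) auto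
  then have ev1: "eventually (\<lambda>n. K * r ^ n < 1 / 2) sequentially"
    by (rule order_tendstoD) auto
  have "(\<lambda>n. (1 + limit_gap g) * K * (real n * r ^ n)) \<longlonglongrightarrow> (1 + limit_gap g) * K * 0"
    using K by (intro tendsto_mult_left powser_times_n_limit_0) auto
  then have ev2: "eventually (\<lambda>n. (1 + limit_gap g) * K * (real n * r ^ n) < \<epsilon> / 2) sequentially"
    by (rule order_tendstoD) (use \<epsilon> in auto)
  show "eventually (\<lambda>n. dist (Pn s b a n g) (limit_gap g) < e) sequentially"
    using ev1 ev2 eventually_ge_at_top[of 1]
  proof eventually_elim
    case (elim n)
    let ?c = "real (card (Iint b a n))" and ?d = "real (card (deviant n g \<epsilon>))"
    let ?S = "\<Sum>z\<in>Iint b a n. gap_total z" and ?C = "\<Sum>z\<in>Iint b a n. gap_count z g"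
    have c: "0 < ?c" using card_Iint_pos elim by simp
    have d: "?d \<le> K * r ^ n * ?c" using K(4) elim by auto
    also have "\<dots> \<le> 1 / 2 * ?c" using elim c by (intro mult_right_mono) auto
    finally have S: "?c / 2 \<le> ?S" using sum_gap_total_ge[of n g \<epsilon>] by simp
    have "(1 + limit_gap g) * n * ?d \<le> (1 + limit_gap g) * n * (K * r ^ n * ?c)"
      using d limit_gap_nonneg[of g] by (intro mult_left_mono) auto
    also have "\<dots> = (1 + limit_gap g) * K * (real n * r ^ n) * ?c" by simp
    also have "\<dots> \<le> \<epsilon> / 2 * ?c" using elim c by (intro mult_right_mono) auto
    also have "\<dots> = \<epsilon> * (?c / 2)" by simp
    also have "\<dots> \<le> \<epsilon> * ?S" using S \<epsilon> by (intro mult_left_mono) auto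
    finally have "\<bar>?C - limit_gap g * ?S\<bar> \<le> 2 * \<epsilon> * ?S"
      using sum_gap_deviation_le[of n \<epsilon> g] elim \<epsilon> by simp
    moreover have "0 < ?S" using S c by simp
    moreover have "Pn s b a n g = ?C / ?S" by (simp add: Pn_def)
    ultimately have "\<bar>Pn s b a n g - limit_gap g\<bar> \<le> 2 * \<epsilon>"
      by (simp add: abs_divide_diff pos_divide_le_eq)
    then show ?case using \<open>0 < e\<close> by (simp add: dist_real_def \<epsilon>_def)
  qed
qed

lemma Plim_eq: "Plim s b a g = limit_gap g"
  unfolding Plim_def using Pn_tendsto by (rule limI)

section \<open>Almost sure convergence for independent uniform choices\<close>

abbreviation choices :: "(nat \<Rightarrow> nat) measure" where
  "choices \<equiv> PiM {1..} (\<lambda>n. uniform_count_measure (Iint b a n))"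

lemma prob_space_Iint: "1 \<le> n \<Longrightarrow> prob_space (uniform_count_measure (Iint b a n))"
  using card_Iint_pos[of n] finite_Iint by (intro prob_space_uniform_count_measure) auto

lemma prob_space_choices: "prob_space choices"
  by (rule prob_space_PiM) (simp add: prob_space_Iint)

text \<open>Coordinate \<open>n\<close> of the product space is uniform on
  \<open>Iint b a n\<close>, so deviance has geometrically small probability and Borel-Cantelli
  applies. The shift to \<open>Suc n\<close> keeps coordinates in \<open>{1..}\<close>.\<close>

lemma AE_eventually_not_deviant:
  assumes "0 < \<epsilon>"
  shows "AE \<omega> in choices. eventually (\<lambda>n. \<omega> (Suc n) \<in> Iint b a (Suc n) - deviant (Suc n) g \<epsilon>) sequentially"
proof -
  interpret prob_space choices by (rule prob_space_choices)
  obtain K r :: real where K: "0 \<le> K" "0 < r" "r < 1"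
    "\<forall>n\<ge>1. card (deviant n g \<epsilon>) \<le> K * r ^ n * card (Iint b a n)"
    by (rule card_deviant_le[OF assms, of g])
  define A where "A n = (\<lambda>\<omega>. \<omega> (Suc n)) -` deviant (Suc n) g \<epsilon> \<inter> space choices" for n
  have sub: "deviant n g \<epsilon> \<subseteq> Iint b a n" for n by (auto simp: deviant_def)
  have meas: "(\<lambda>\<omega>. \<omega> (Suc n)) \<in> choices \<rightarrow>\<^sub>M uniform_count_measure (Iint b a (Suc n))" for n
    by (rule measurable_component_singleton) simp
  have A: "A n \<in> sets choices" for n
    unfolding A_def using meas by (rule measurable_sets) (use sub in \<open>auto simp: sets_uniform_count_measure\<close>)
  have bound: "prob (A n) \<le> K * r ^ Suc n" for n
  proof -
    let ?M = "uniform_count_measure (Iint b a (Suc n))"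
    have "prob (A n) = measure (distr choices ?M (\<lambda>\<omega>. \<omega> (Suc n))) (deviant (Suc n) g \<epsilon>)"
      unfolding A_def using meas sub by (subst measure_distr) (auto simp: sets_uniform_count_measure)
    also have "distr choices ?M (\<lambda>\<omega>. \<omega> (Suc n)) = ?M"
      by (rule distr_PiM_component) (auto simp: prob_space_Iint)
    also have "measure ?M (deviant (Suc n) g \<epsilon>) = card (deviant (Suc n) g \<epsilon>) / card (Iint b a (Suc n))"
      by (rule measure_uniform_count_measure[OF finite_Iint sub])
    also have "\<dots> \<le> K * r ^ Suc n"
      using K(4)[rule_format, of "Suc n"] card_Iint_pos[of "Suc n"]
      by (simp add: divide_le_eq del: power_Suc)
    finally show ?thesis .
  qed
  have "summable (\<lambda>n. K * r ^ Suc n)"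
    using K by (simp add: summable_mult summable_geometric)
  then have "summable (\<lambda>n. prob (A n))"
    by (rule summable_comparison_test'[where N = 0]) (simp only: real_norm_def abs_of_nonneg measure_nonneg bound)
  then have "AE \<omega> in choices. eventually (\<lambda>n. \<omega> \<in> space choices - A n) sequentially"
    by (intro borel_cantelli_AE1 A) (simp_all only: emeasure_eq_measure infinity_ennreal_def ennreal_less_top)
  then show ?thesis
  proof (rule AE_mp, intro AE_I2 impI)
    fix \<omega> assume "\<forall>\<^sub>F n in sequentially. \<omega> \<in> space choices - A n"
    then show "\<forall>\<^sub>F n in sequentially. \<omega> (Suc n) \<in> Iint b a (Suc n) - deviant (Suc n) g \<epsilon>"
    proof eventually_elim
      case (elim n)
      then have "\<omega> (Suc n) \<in> space (uniform_count_measure (Iint b a (Suc n)))"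
        by (intro measurable_space[OF meas]) auto
      then show ?case using elim by (auto simp: A_def space_uniform_count_measure)
    qed
  qed
qed

text \<open>Integers \<open>g\<close> and tolerances \<open>1 / (k + 1)\<close> are countably many,
  so one null set serves them all.\<close>

lemma AE_gap_frequency_tendsto:
  "AE \<omega> in choices. \<forall>g. (\<lambda>n. gap_count (\<omega> (Suc n)) g / gap_total (\<omega> (Suc n))) \<longlonglongrightarrow> limit_gap g"
proof -
  have "AE \<omega> in choices. \<forall>g. \<forall>k. eventually
      (\<lambda>n. \<omega> (Suc n) \<in> Iint b a (Suc n) - deviant (Suc n) g (1 / real (Suc k))) sequentially"
    unfolding AE_all_countable by (intro allI AE_eventually_not_deviant) simp
  then show ?thesis
  proof (rule AE_mp, intro AE_I2 impI allI)
    fix \<omega> g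
    assume *: "\<forall>g. \<forall>k. eventually
      (\<lambda>n. \<omega> (Suc n) \<in> Iint b a (Suc n) - deviant (Suc n) g (1 / real (Suc k))) sequentially"
    show "(\<lambda>n. gap_count (\<omega> (Suc n)) g / gap_total (\<omega> (Suc n))) \<longlonglongrightarrow> limit_gap g"
    proof (rule tendstoI)
      fix e :: real assume "0 < e"
      then obtain k where k: "1 / real (Suc k) < e" by (metis nat_approx_posE)
      have "eventually (\<lambda>n. \<omega> (Suc n) \<in> Iint b a (Suc n) - deviant (Suc n) g (1 / real (Suc k))) sequentially"
        using * by blast
      then show "eventually (\<lambda>n. dist (gap_count (\<omega> (Suc n)) g / gap_total (\<omega> (Suc n))) (limit_gap g) < e) sequentially"
      proof eventually_elim
        case (elim n)
        define c t where "c = gap_count (\<omega> (Suc n)) g" and "t = gap_total (\<omega> (Suc n))"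
        have t: "0 < t" and "\<bar>c - limit_gap g * t\<bar> < 1 / real (Suc k) * t"
          using not_deviantD[OF elim] unfolding c_def t_def by auto
        then have "\<bar>c / t - limit_gap g\<bar> < 1 / real (Suc k)"
          by (simp only: abs_divide_diff pos_divide_less_eq)
        then show ?case using k unfolding dist_real_def c_def t_def by simp
      qed
    qed
  qed
qed

lemma AE_weak_conv:
  "AE \<omega> in choices. weak_conv_m (\<lambda>n. gap_measure s b a (\<omega> (Suc n))) (avg_gap_measure s b a)"
proof (rule AE_mp[OF AE_gap_frequency_tendsto], intro AE_I2 impI)
  fix \<omega> assume \<omega>: "\<omega> \<in> space choices"
    and lim: "\<forall>g. (\<lambda>n. gap_count (\<omega> (Suc n)) g / gap_total (\<omega> (Suc n))) \<longlonglongrightarrow> limit_gap g"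
  have zero: "gap_count (\<omega> (Suc n)) g = 0" if "g \<le> 0" for n g
  proof -
    have "\<omega> (Suc n) \<in> Iint b a (Suc n)"
      using \<omega> by (auto simp: space_PiM PiE_iff space_uniform_count_measure)
    then show ?thesis
      using bin_gaps_greater[of "Suc n" "\<omega> (Suc n)"] that by (force simp: count_list_0_iff)
  qed
  have "cdf (gap_measure s b a (\<omega> (Suc n))) x =
      (\<Sum>g\<in>{1..\<lfloor>x\<rfloor>}. gap_count (\<omega> (Suc n)) g / gap_total (\<omega> (Suc n)))" for n x
    \<comment> \<open>An element without gaps gives weights \<open>0 / 0 = 0\<close>, so the formula
      covers it as well.\<close>
    unfolding gap_measure_def by (rule cdf_point_masses) (use zero in auto)
  moreover have "cdf (avg_gap_measure s b a) x = (\<Sum>g\<in>{1..\<lfloor>x\<rfloor>}. limit_gap g)" for x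
    unfolding avg_gap_measure_def Plim_eq
    by (rule cdf_point_masses) (rule limit_gap_nonneg, simp add: limit_gap_def gap_weight_def)
  ultimately show "weak_conv_m (\<lambda>n. gap_measure s b a (\<omega> (Suc n))) (avg_gap_measure s b a)"
    unfolding weak_conv_m_def weak_conv_def using lim by (auto intro!: tendsto_sum)
qed

end

theorem theorem1p16:
  fixes s b :: nat and a :: "nat \<Rightarrow> nat"
  assumes "s \<ge> 1" and "b \<ge> 1" and "is_generacci s b a"
  shows "(\<forall>g. convergent (\<lambda>n. Pn s b a n g)) \<and>
         (AE \<omega> in PiM {1..} (\<lambda>n. uniform_count_measure (Iint b a n)).
            weak_conv_m (\<lambda>n. gap_measure s b a (\<omega> (Suc n))) (avg_gap_measure s b a))"
proof -
  interpret generacci s b a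
    using assms by unfold_locales auto
  show ?thesis
    using Pn_tendsto AE_weak_conv by (auto intro: convergentI)
qed

end
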